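(* For each $s \in (0,1]$, the set $\mathcal{D}^{(s)}_{\mathrm{div}} = \{ x \in [0,1] : \sum_{n \in \mathbb{N}} 1/(d_n(x))^{s} \text{ diverges} \}$ is dense $G_\delta$, hence comeager and nonmeager, in $[0,1]$, and has cardinality $\mathfrak{c}$, i.e., the cardinality of $\mathbb{R}$.
   Context: Pierce digits. For $x \in [0,1]$, define $d_1(x) := \lfloor 1/x \rfloor$ and $T(x) := 1 - d_1(x)\,x$ if $x \neq 0$, and $d_1(0) := \infty$, $T(0) := 0$. Here $\lfloor y \rfloor$ is the largest integer not exceeding $y$. For $n \in \mathbb{N} = \{1,2,3,\dots\}$ put $d_n(x) := d_1(T^{n-1}(x))$, where $T^{n-1}$ is the $(n-1)$-fold iterate of $T$ ($T^0$ is the identity). The sequence $(d_n(x))_{n \in \mathbb{N}}$ is the Pierce expansion digit sequence of $x$. Conventions: $\infty^s := \infty$ for $s>0$ and $c/\infty := 0$ for $c \in \mathbb{R}$. A subset $A$ of a topological space $X$ is meager in $X$ if it is a countable union of nowhere dense subsets of $X$, nonmeager otherwise, and comeager in $X$ if $X \setminus A$ is meager in $X$. The interval $[0,1]$ carries the subspace topology induced by the standard topology of $\mathbb{R}$. *)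

theory Defs
  imports "HOL-Analysis.Analysis" "HOL-Library.Extended_Nat" "HOL-Library.Equipollence"
begin

(* Pierce expansions are only meaningful for x in [0,1], an interval which pierce_T maps into
   itself; the values of the functions below outside [0,1] are irrelevant. *)

definition pierce_d1 :: "real \<Rightarrow> enat" where
  "pierce_d1 x = (if x = 0 then \<infinity> else enat (nat \<lfloor>1 / x\<rfloor>))"

definition pierce_T :: "real \<Rightarrow> real" where
  "pierce_T x = (if x = 0 then 0 else 1 - real (the_enat (pierce_d1 x)) * x)"

(* Digits are numbered from n = 1 on. *)
definition pierce_digit :: "nat \<Rightarrow> real \<Rightarrow> enat" where
  "pierce_digit n x = pierce_d1 ((pierce_T ^^ (n - 1)) x)"

(* Powers with exponent s > 0; this is where the convention \<infinity>^s = \<infinity> enters. *)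
fun enat_powr :: "enat \<Rightarrow> real \<Rightarrow> ereal" where
  "enat_powr (enat k) s = ereal (real k powr s)"
| "enat_powr \<infinity> s = \<infinity>"

(* For x in [0,1] all digits are at least 1, so the ereal quotient (in which 1 / \<infinity> = 0) is
   finite and real_of_ereal loses nothing. The shift by Suc makes the series start at digit 1. *)
definition pierce_div_set :: "real \<Rightarrow> real set" where
  "pierce_div_set s =
     {x \<in> {0..1}. \<not> summable (\<lambda>n. real_of_ereal (1 / enat_powr (pierce_digit (Suc n) x) s))}"

definition nowhere_dense_in :: "'a topology \<Rightarrow> 'a set \<Rightarrow> bool" where
  "nowhere_dense_in X A \<longleftrightarrow> A \<subseteq> topspace X \<and> X interior_of (X closure_of A) = {}"

definition meager_in :: "'a topology \<Rightarrow> 'a set \<Rightarrow> bool" where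
  "meager_in X A \<longleftrightarrow> (\<exists>\<N>. countable \<N> \<and> (\<forall>N\<in>\<N>. nowhere_dense_in X N) \<and> A = \<Union>\<N>)"

definition nonmeager_in :: "'a topology \<Rightarrow> 'a set \<Rightarrow> bool" where
  "nonmeager_in X A \<longleftrightarrow> A \<subseteq> topspace X \<and> \<not> meager_in X A"

definition comeager_in :: "'a topology \<Rightarrow> 'a set \<Rightarrow> bool" where
  "comeager_in X A \<longleftrightarrow> A \<subseteq> topspace X \<and> meager_in X (topspace X - A)"

end

theory Submission
  imports Defs
begin

text \<open>
  Write \<open>D\<close> for the set of points whose series diverges. All five claims follow from \<open>D\<close> being
  a dense \<open>G\<^sub>\<delta>\<close>, because \<open>[0,1]\<close> is a nonempty complete metric space without isolated points: the
  complement of a dense \<open>G\<^sub>\<delta>\<close> is meager, Baire's theorem makes comeager sets nonmeager, and a dense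
  \<open>G\<^sub>\<delta>\<close> is itself a completely metrizable space without isolated points, hence has at least the
  cardinality of the continuum.

  \<^emph>\<open>\<open>G\<^sub>\<delta>\<close>.\<close> A series of nonnegative terms diverges iff for every \<open>M\<close> some partial sum exceeds \<open>M\<close>.
  The first \<open>N\<close> digits of \<open>x\<close> are locally constant at \<open>x\<close> as long as the orbit of \<open>x\<close> under the
  Pierce map does not reach \<open>0\<close> within \<open>N\<close> steps, so for such \<open>x\<close> the condition on the partial sum
  is open. An orbit that reaches \<open>0\<close> stays there and contributes only finitely many nonzero terms,
  so imposing that restriction loses no point of \<open>D\<close>.

  \<^emph>\<open>Density.\<close> Dropping the first digit does not affect divergence, so \<open>x \<in> D\<close> iff \<open>T x \<in> D\<close>.
  Pulling points near \<open>T x\<close> back along the branch of \<open>T\<close> at \<open>x\<close> shows that \<open>x\<close> lies in the closure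
  of \<open>D\<close> whenever \<open>T x\<close> does. The orbit of a rational \<open>p/q\<close> has numerators \<open>p > q mod p > \<dots>\<close> and so
  ends in \<open>0\<close>; thus it is enough to find points of \<open>D\<close> arbitrarily close to \<open>0\<close>. These are the
  numbers with digit sequence \<open>m+1, m+2, m+3, \<dots>\<close>, for which the series dominates a tail of
  the harmonic series as \<open>s \<le> 1\<close>. They have the closed form \<open>\<integral>\<^sub>0\<^sup>1 t\<^sup>m exp (t-1) dt\<close>.
\<close>

section \<open>Dense \<open>G\<^sub>\<delta>\<close> sets in completely metrizable spaces\<close>

lemma dense_gdelta_imp_comeager_in:
  assumes "gdelta_in X A" and dense: "X closure_of A = topspace X"
  shows "comeager_in X A"
proof -
  obtain \<U> where \<U>: "countable \<U>" "A = \<Inter>\<U>" "\<And>U. U \<in> \<U> \<Longrightarrow> openin X U" and sub: "A \<subseteq> topspace X"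
    using assms(1) unfolding gdelta_in_alt intersection_of_def by auto
  have "nowhere_dense_in X (topspace X - U)" if "U \<in> \<U>" for U
  proof -
    have "closedin X (topspace X - U)"
      using \<U>(3)[OF that] by blast
    moreover have "topspace X \<subseteq> X closure_of U"
      using closure_of_mono[of A U X] \<U>(2) that dense by auto
    ultimately show ?thesis
      by (simp add: nowhere_dense_in_def closure_of_closedin interior_of_complement)
  qed
  moreover have "topspace X - A = \<Union>((\<lambda>U. topspace X - U) ` \<U>)"
    using \<U>(2) by auto
  ultimately have "meager_in X (topspace X - A)"
    using \<U>(1) unfolding meager_in_def
    by (intro exI[of _ "(\<lambda>U. topspace X - U) ` \<U>"]) auto
  then show ?thesis
    using sub by (simp add: comeager_in_def)
qed

text \<open>If a comeager set were meager, the whole space would be a countable union of nowhere dense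
  sets, which Baire's theorem forbids.\<close>

lemma comeager_in_imp_nonmeager_in:
  assumes "completely_metrizable_space X" and ne: "topspace X \<noteq> {}" and "comeager_in X A"
  shows "nonmeager_in X A"
proof -
  have False if "meager_in X A"
  proof -
    obtain \<M> \<N> where "countable \<M>" "countable \<N>"
      and nd: "\<And>N. N \<in> \<M> \<union> \<N> \<Longrightarrow> nowhere_dense_in X N"
      and eq: "A = \<Union>\<M>" "topspace X - A = \<Union>\<N>"
      using \<open>meager_in X A\<close> assms(3) unfolding comeager_in_def meager_in_def
      by (metis UnE)
    let ?\<F> = "(\<lambda>N. X closure_of N) ` (\<M> \<union> \<N>)"
    have "X interior_of \<Union>?\<F> = {}"
      using assms(1) \<open>countable \<M>\<close> \<open>countable \<N>\<close> nd
      by (intro Baire_category_alt) (auto simp: nowhere_dense_in_def)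
    moreover have "N \<subseteq> X closure_of N" if "N \<in> \<M> \<union> \<N>" for N
      using nd[OF that] by (simp add: closure_of_subset nowhere_dense_in_def)
    then have "topspace X \<subseteq> \<Union>?\<F>"
      using eq by blast
    then have "\<Union>?\<F> = topspace X"
      using closure_of_subset_topspace by fast
    ultimately show False
      using ne by simp
  qed
  then show ?thesis
    using assms(3) by (auto simp: nonmeager_in_def comeager_in_def)
qed

text \<open>Removing a point from a nonempty open set leaves a nonempty open set, which still meets a
  dense set \<open>A\<close>. So \<open>A\<close> has no isolated points either and is a perfect set in the completely
  metrizable space \<open>A\<close>.\<close>

lemma reals_lepoll_dense_gdelta:
  assumes X: "completely_metrizable_space X" and ne: "topspace X \<noteq> {}"
    and no_isolated: "\<And>x. \<not> openin X {x}"
    and gdelta: "gdelta_in X A" and dense: "X closure_of A = topspace X"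
  shows "(UNIV :: real set) \<lesssim> A"
proof (rule lepoll_perfect_set)
  show "completely_metrizable_space (subtopology X A) \<or>
        locally_compact_space (subtopology X A) \<and> Hausdorff_space (subtopology X A)"
    using completely_metrizable_space_gdelta_in[OF X gdelta] by simp
  have t1: "t1_space X"
    using X by (simp add: completely_metrizable_imp_metrizable_space metrizable_imp_t1_space)
  have sub: "A \<subseteq> topspace X"
    using gdelta by (simp add: gdelta_in_alt)
  have "x \<in> X derived_set_of A" if "x \<in> A" for x
    unfolding in_derived_set_of
  proof (intro conjI allI impI)
    show "x \<in> topspace X"
      using that sub by auto
    fix U assume U: "x \<in> U \<and> openin X U"
    then have "openin X (U - {x})"
      using t1 by (simp add: t1_space_openin_delete)
    moreover have "U - {x} \<noteq> {}"
      using U no_isolated[of x] by (metis Diff_eq_empty_iff empty_iff subset_singletonD)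
    moreover have "U - {x} \<subseteq> X closure_of A"
      using U dense openin_subset by auto
    ultimately have "A \<inter> (U - {x}) \<noteq> {}"
      using openin_Int_closure_of_eq_empty by fastforce
    then show "\<exists>y. y \<noteq> x \<and> y \<in> A \<and> y \<in> U"
      by blast
  qed
  then show "subtopology X A derived_set_of A = A"
    by (auto simp: derived_set_of_subtopology)
  show "A \<noteq> {}"
    using dense ne by (metis closure_of_empty)
qed

lemma not_openin_singleton_unit_interval: "\<not> openin (top_of_set {0..1::real}) {x}"
proof
  assume "openin (top_of_set {0..1::real}) {x}"
  moreover from this have "closedin (top_of_set {0..1::real}) {x}"
    by (intro closed_subset) (auto dest: openin_imp_subset)
  ultimately have "{x} = {0..1::real}"
    using connected_clopen[of "{0..1::real}"] by auto
  then have "(0::real) \<in> {x}" "(1::real) \<in> {x}"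
    by simp_all
  then show False
    by simp
qed

section \<open>The Pierce map and its orbits\<close>

lemma pierce_T_0 [simp]: "pierce_T 0 = 0"
  by (simp add: pierce_T_def)

lemma pierce_d1_eq_of_bounds:
  assumes "0 < x" "real k * x \<le> 1" "1 < (real k + 1) * x"
  shows "pierce_d1 x = enat k"
proof -
  have "\<lfloor>1 / x\<rfloor> = int k"
    using assms by (intro floor_unique) (simp_all add: field_simps)
  then show ?thesis
    using assms(1) by (simp add: pierce_d1_def)
qed

lemma pierce_T_of_pos: "x > 0 \<Longrightarrow> pierce_T x = 1 - real (nat \<lfloor>1 / x\<rfloor>) * x"
  by (simp add: pierce_T_def pierce_d1_def)

text \<open>The digit jumps only where \<open>1/x\<close> is an integer, and these are exactly the positive points
  that the Pierce map sends to \<open>0\<close>. On the negative axis the digit is constantly \<open>0\<close>.\<close>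

lemma eventually_pierce_d1_eq:
  assumes "x \<noteq> 0" "pierce_T x \<noteq> 0"
  shows "\<forall>\<^sub>F z in nhds x. pierce_d1 z = pierce_d1 x"
proof (cases "x > 0")
  case True
  define k where "k = nat \<lfloor>1 / x\<rfloor>"
  have k: "real k = of_int \<lfloor>1 / x\<rfloor>"
    using True by (simp add: k_def)
  have "real k \<le> 1 / x" "1 / x < real k + 1"
    unfolding k by linarith+
  then have "real k * x \<le> 1" "1 < (real k + 1) * x"
    using True by (simp_all add: field_simps)
  moreover have "real k * x \<noteq> 1"
    using assms(2) True by (simp add: pierce_T_of_pos k_def)
  ultimately have less: "real k * x < 1" "1 < (real k + 1) * x"
    by auto
  have "\<forall>\<^sub>F z in nhds x. z > 0 \<and> real k * z < 1 \<and> 1 < (real k + 1) * z"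
  proof (intro eventually_conj)
    show "\<forall>\<^sub>F z in nhds x. z > 0"
      using True by (rule order_tendstoD(1)[OF filterlim_ident])
    show "\<forall>\<^sub>F z in nhds x. real k * z < 1"
      using less(1) by (rule order_tendstoD(2)[rotated]) (intro tendsto_intros filterlim_ident)
    show "\<forall>\<^sub>F z in nhds x. 1 < (real k + 1) * z"
      using less(2) by (rule order_tendstoD(1)[rotated]) (intro tendsto_intros filterlim_ident)
  qed
  then show ?thesis
    by eventually_elim
      (use less True in \<open>simp add: pierce_d1_eq_of_bounds[of x k] pierce_d1_eq_of_bounds[of _ k]\<close>)
next
  case False
  then have "x < 0"
    using assms(1) by simp
  then have "\<forall>\<^sub>F z in nhds x. z < 0"
    by (intro order_tendstoD[OF filterlim_ident])
  moreover have d1_neg: "pierce_d1 z = enat 0" if "z < 0" for z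
  proof -
    have "\<lfloor>1 / z\<rfloor> \<le> 0"
      using that by (simp add: floor_le_iff divide_less_eq)
    then show ?thesis
      using that by (simp add: pierce_d1_def)
  qed
  ultimately show ?thesis
    using \<open>x < 0\<close> by (auto elim: eventually_mono)
qed

lemma isCont_pierce_T:
  assumes "x \<noteq> 0" "pierce_T x \<noteq> 0"
  shows "isCont pierce_T x"
proof -
  let ?c = "real (the_enat (pierce_d1 x))"
  have "\<forall>\<^sub>F z in nhds x. z \<noteq> 0"
    using assms(1) by (intro t1_space_nhds)
  then have "\<forall>\<^sub>F z in nhds x. pierce_T z = 1 - ?c * z"
    using eventually_pierce_d1_eq[OF assms] by eventually_elim (simp add: pierce_T_def)
  moreover have "isCont (\<lambda>z. 1 - ?c * z) x"
    by simp
  ultimately show ?thesis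
    by (simp add: isCont_cong)
qed

text \<open>Continuity of the iterate and local constancy of the next digit have to be carried along
  together: the digit after \<open>n\<close> steps is constant near \<open>T\<^sup>n x\<close>, and this is transported to \<open>x\<close> by
  continuity of \<open>T\<^sup>n\<close>.\<close>

lemma isCont_pierce_T_funpow:
  assumes "\<forall>k\<le>n. (pierce_T ^^ k) x \<noteq> 0"
  shows "isCont (pierce_T ^^ n) x"
  using assms
proof (induction n)
  case 0
  then show ?case by (simp add: id_def)
next
  case (Suc n)
  have "isCont pierce_T ((pierce_T ^^ n) x)"
    using Suc.prems by (intro isCont_pierce_T) (auto dest: spec[of _ "Suc n"])
  moreover have "isCont (pierce_T ^^ n) x"
    using Suc by simp
  ultimately show ?case
    by (simp add: comp_def isCont_o2)
qed

lemma eventually_pierce_digits_eq: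
  assumes "\<forall>k\<le>N. (pierce_T ^^ k) x \<noteq> 0"
  shows "\<forall>\<^sub>F z in nhds x. (\<forall>k\<le>N. (pierce_T ^^ k) z \<noteq> 0) \<and>
           (\<forall>n<N. pierce_digit (Suc n) z = pierce_digit (Suc n) x)"
proof -
  have lim: "filterlim (pierce_T ^^ k) (nhds ((pierce_T ^^ k) x)) (nhds x)" if "k \<le> N" for k
    using isCont_pierce_T_funpow[of k x] assms that by (simp add: isCont_def tendsto_at_iff_tendsto_nhds)
  have "\<forall>\<^sub>F z in nhds x. \<forall>k\<in>{..N}. (pierce_T ^^ k) z \<noteq> 0"
  proof (intro eventually_ball_finite ballI)
    fix k assume "k \<in> {..N}"
    then show "\<forall>\<^sub>F z in nhds x. (pierce_T ^^ k) z \<noteq> 0"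
      using assms by (intro eventually_compose_filterlim[OF t1_space_nhds lim]) auto
  qed simp
  moreover have "\<forall>\<^sub>F z in nhds x. \<forall>n\<in>{..<N}. pierce_digit (Suc n) z = pierce_digit (Suc n) x"
  proof (intro eventually_ball_finite ballI)
    fix n assume "n \<in> {..<N}"
    then have "(pierce_T ^^ n) x \<noteq> 0" "pierce_T ((pierce_T ^^ n) x) \<noteq> 0"
      using assms by (auto dest: spec[of _ "Suc n"])
    then show "\<forall>\<^sub>F z in nhds x. pierce_digit (Suc n) z = pierce_digit (Suc n) x"
      using eventually_compose_filterlim[OF eventually_pierce_d1_eq lim] \<open>n \<in> {..<N}\<close>
      by (simp add: pierce_digit_def)
  qed simp
  ultimately show ?thesis
    by eventually_elim auto
qed

section \<open>The divergence set is \<open>G\<^sub>\<delta>\<close>\<close>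

definition pierce_term :: "real \<Rightarrow> real \<Rightarrow> nat \<Rightarrow> real" where
  "pierce_term s x n = real_of_ereal (1 / enat_powr (pierce_digit (Suc n) x) s)"

lemma pierce_div_set_eq: "pierce_div_set s = {x \<in> {0..1}. \<not> summable (pierce_term s x)}"
  by (simp add: pierce_div_set_def pierce_term_def[abs_def])

lemma real_of_ereal_inverse_enat_powr: "real_of_ereal (1 / enat_powr (enat k) s) = 1 / real k powr s"
  by (cases "real k powr s = 0") (simp_all add: one_ereal_def)

lemma pierce_term_nonneg: "pierce_term s x n \<ge> 0"
  by (cases "pierce_digit (Suc n) x")
    (simp_all add: pierce_term_def real_of_ereal_inverse_enat_powr del: enat_powr.simps(1))

lemma pierce_term_eq_0:
  assumes "(pierce_T ^^ k) x = 0" "k \<le> n"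
  shows "pierce_term s x n = 0"
proof -
  have "(pierce_T ^^ j) 0 = 0" for j
    by (induction j) auto
  moreover have "(pierce_T ^^ n) x = (pierce_T ^^ (n - k)) ((pierce_T ^^ k) x)"
    using assms(2) by (metis funpow_add comp_apply le_add_diff_inverse2)
  ultimately show ?thesis
    using assms(1) by (simp add: pierce_term_def pierce_digit_def pierce_d1_def)
qed

lemma not_summable_iff_partial_sums_unbounded:
  fixes f :: "nat \<Rightarrow> real"
  assumes "\<And>n. f n \<ge> 0"
  shows "\<not> summable f \<longleftrightarrow> (\<forall>M::nat. \<exists>N. real M < (\<Sum>n<N. f n))"
proof
  assume div: "\<not> summable f"
  show "\<forall>M::nat. \<exists>N. real M < (\<Sum>n<N. f n)"
  proof (rule ccontr)
    assume "\<not> ?thesis"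
    then obtain M :: nat where "\<And>N. (\<Sum>n<N. f n) \<le> real M"
      by (auto simp: not_less)
    then show False
      using summableI_nonneg_bounded[of f "real M"] assms div by auto
  qed
next
  assume unb: "\<forall>M::nat. \<exists>N. real M < (\<Sum>n<N. f n)"
  show "\<not> summable f"
  proof
    assume "summable f"
    then have "(\<Sum>n<N. f n) \<le> suminf f" for N
      using assms by (intro sum_le_suminf) auto
    moreover obtain M :: nat where "suminf f \<le> real M"
      using real_arch_simple by blast
    moreover obtain N where "real M < (\<Sum>n<N. f n)"
      using unb by blast
    ultimately show False
      by (meson not_less order_trans)
  qed
qed

text \<open>The orbit condition is there to make the set open: where the orbit hits \<open>0\<close>, the Pierce map is
  discontinuous and arbitrarily close points may have different early digits.\<close>

definition pierce_large_set :: "real \<Rightarrow> nat \<Rightarrow> real set" where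
  "pierce_large_set s M =
     {x. \<exists>N. (\<forall>k\<le>N. (pierce_T ^^ k) x \<noteq> 0) \<and> real M < (\<Sum>n<N. pierce_term s x n)}"

lemma open_pierce_large_set: "open (pierce_large_set s M)"
proof -
  have "\<forall>\<^sub>F z in nhds x. z \<in> pierce_large_set s M" if x: "x \<in> pierce_large_set s M" for x
  proof -
    obtain N where "\<forall>k\<le>N. (pierce_T ^^ k) x \<noteq> 0"
      and N: "real M < (\<Sum>n<N. pierce_term s x n)"
      using x by (auto simp: pierce_large_set_def)
    from eventually_pierce_digits_eq[OF this(1)] show ?thesis
    proof eventually_elim
      case (elim z)
      then have "(\<Sum>n<N. pierce_term s z n) = (\<Sum>n<N. pierce_term s x n)"
        by (simp add: pierce_term_def)
      then show ?case
        using elim N by (auto simp: pierce_large_set_def)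
    qed
  qed
  then show ?thesis
    by (subst open_subopen) (simp add: eventually_nhds subset_eq)
qed

lemma not_summable_pierce_term_iff:
  "\<not> summable (pierce_term s x) \<longleftrightarrow> (\<forall>M::nat. \<exists>N. real M < (\<Sum>n<N. pierce_term s x n))"
  by (rule not_summable_iff_partial_sums_unbounded) (rule pierce_term_nonneg)

lemma pierce_div_set_eq_INT: "pierce_div_set s = (\<Inter>M. {0..1} \<inter> pierce_large_set s M)"
proof (intro set_eqI iffI)
  fix x assume "x \<in> pierce_div_set s"
  then have x: "x \<in> {0..1}" and div: "\<not> summable (pierce_term s x)"
    by (simp_all add: pierce_div_set_eq)
  have orbit: "(pierce_T ^^ k) x \<noteq> 0" for k
  proof
    assume "(pierce_T ^^ k) x = 0"
    then have "pierce_term s x n = 0" if "n \<notin> {..<k}" for n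
      using that pierce_term_eq_0[of k x n s] by simp
    then have "summable (pierce_term s x)"
      by (intro summable_finite[of "{..<k}"]) simp_all
    then show False
      using div by simp
  qed
  have "\<exists>N. real M < (\<Sum>n<N. pierce_term s x n)" for M
    using div unfolding not_summable_pierce_term_iff by (rule spec)
  then have "x \<in> pierce_large_set s M" for M
    by (simp add: pierce_large_set_def orbit)
  then show "x \<in> (\<Inter>M. {0..1} \<inter> pierce_large_set s M)"
    using x by simp
next
  fix x assume "x \<in> (\<Inter>M. {0..1} \<inter> pierce_large_set s M)"
  then have x: "x \<in> {0..1}" and large: "x \<in> pierce_large_set s M" for M
    by simp_all
  have "\<exists>N. real M < (\<Sum>n<N. pierce_term s x n)" for M
    using large[of M] by (auto simp: pierce_large_set_def)
  then have "\<not> summable (pierce_term s x)"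
    unfolding not_summable_pierce_term_iff by (rule allI)
  then show "x \<in> pierce_div_set s"
    using x by (simp add: pierce_div_set_eq)
qed

lemma gdelta_in_pierce_div_set: "gdelta_in (top_of_set {0..1}) (pierce_div_set s)"
  unfolding pierce_div_set_eq_INT
proof (rule gdelta_in_Inter)
  fix S assume "S \<in> range (\<lambda>M. {0..1} \<inter> pierce_large_set s M)"
  then obtain M where S: "S = {0..1} \<inter> pierce_large_set s M"
    by blast
  show "gdelta_in (top_of_set {0..1}) S"
    unfolding S by (intro open_imp_gdelta_in openin_open_Int open_pierce_large_set)
qed simp_all

section \<open>Points with consecutive digits\<close>

text \<open>The number whose Pierce digits are \<open>m+1, m+2, m+3, \<dots>\<close>. A number with first digit \<open>m+1\<close>
  satisfies \<open>T y = 1 - (m+1) y\<close>, and integration by parts shows that these integrals obey this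
  recursion; being integrals of functions with values in \<open>[0,1]\<close>, they stay in the range where
  the recursion is a step of the Pierce map.\<close>

definition consecutive_pierce :: "nat \<Rightarrow> real" where
  "consecutive_pierce m = integral {0..1} (\<lambda>t. t ^ m * exp (t - 1))"

lemma consecutive_pierce_integrable: "(\<lambda>t::real. t ^ m * exp (t - 1)) integrable_on {0..1}"
  by (intro integrable_continuous_real continuous_intros)

lemma consecutive_pierce_Suc:
  "consecutive_pierce (Suc m) = 1 - real (Suc m) * consecutive_pierce m"
proof -
  have integral: "((\<lambda>t. t ^ m * exp (t - 1)) has_integral consecutive_pierce m) {0..1}" for m
    unfolding consecutive_pierce_def by (rule integrable_integral[OF consecutive_pierce_integrable])
  have "((\<lambda>t. real (Suc m) * (t ^ m * exp (t - 1)) + t ^ Suc m * exp (t - 1)) has_integral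
      (1 ^ Suc m * exp (1 - 1) - 0 ^ Suc m * exp (0 - 1 :: real))) {0..1::real}"
  proof (intro fundamental_theorem_of_calculus)
    fix t :: real
    have "((\<lambda>t. t ^ Suc m * exp (t - 1)) has_field_derivative
        real (Suc m) * (t ^ m * exp (t - 1)) + t ^ Suc m * exp (t - 1)) (at t within {0..1})"
      by (rule derivative_eq_intros refl)+ simp
    then show "((\<lambda>t. t ^ Suc m * exp (t - 1)) has_vector_derivative
        real (Suc m) * (t ^ m * exp (t - 1)) + t ^ Suc m * exp (t - 1)) (at t within {0..1})"
      by (simp only: has_real_derivative_iff_has_vector_derivative)
  qed simp
  moreover have "((\<lambda>t. real (Suc m) * (t ^ m * exp (t - 1)) + t ^ Suc m * exp (t - 1)) has_integral
      real (Suc m) * consecutive_pierce m + consecutive_pierce (Suc m)) {0..1::real}"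
    by (rule has_integral_add[OF has_integral_mult_right[OF integral] integral])
  ultimately have "1 ^ Suc m * exp (1 - 1) - 0 ^ Suc m * exp (0 - 1 :: real) =
      real (Suc m) * consecutive_pierce m + consecutive_pierce (Suc m)"
    by (rule has_integral_unique)
  then show ?thesis
    by simp
qed

lemma consecutive_pierce_nonneg: "0 \<le> consecutive_pierce m"
  unfolding consecutive_pierce_def
  by (intro integral_nonneg consecutive_pierce_integrable) auto

lemma consecutive_pierce_bounds:
  "0 < consecutive_pierce m" "real (Suc m) * consecutive_pierce m \<le> 1"
  "1 < (real (Suc m) + 1) * consecutive_pierce m"
proof -
  show upper: "real (Suc m) * consecutive_pierce m \<le> 1" for m
    using consecutive_pierce_Suc[of m] consecutive_pierce_nonneg[of "Suc m"] by simp
  have pos: "0 < consecutive_pierce m" for m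
  proof -
    have "consecutive_pierce (Suc m) \<le> 1 / real (Suc (Suc m))"
      using upper[of "Suc m"] by (simp add: field_simps)
    also have "\<dots> < 1"
      by simp
    finally show ?thesis
      using consecutive_pierce_Suc[of m] consecutive_pierce_nonneg[of m]
      by (cases "consecutive_pierce m = 0") auto
  qed
  then show "0 < consecutive_pierce m" .
  \<comment> \<open>By the recursion, the remaining bound says that the sequence decreases at \<open>m\<close>; unfolding the
    recursion one step further, this follows from the positivity of the term at \<open>m + 2\<close>.\<close>
  have "consecutive_pierce (Suc m) < consecutive_pierce m"
  proof -
    define a b c where "a = consecutive_pierce m" and "b = consecutive_pierce (Suc m)"
      and "c = consecutive_pierce (Suc (Suc m))"
    have "b = 1 - (real m + 1) * a" "c = 1 - (real m + 2) * b" "c > 0"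
      using consecutive_pierce_Suc[of m] consecutive_pierce_Suc[of "Suc m"] pos
      by (simp_all add: a_def b_def c_def algebra_simps)
    then have "(real m + 2) * b < 1" "(real m + 1) * a = 1 - b"
      by simp_all
    then have "(real m + 1) * b < (real m + 1) * a"
      by (simp add: algebra_simps)
    then show "b < a"
      by (simp add: mult_less_cancel_left_pos)
  qed
  then show "1 < (real (Suc m) + 1) * consecutive_pierce m"
    using consecutive_pierce_Suc[of m] by (simp add: algebra_simps)
qed

lemma pierce_d1_consecutive_pierce: "pierce_d1 (consecutive_pierce m) = enat (Suc m)"
  using consecutive_pierce_bounds by (rule pierce_d1_eq_of_bounds)

lemma pierce_T_consecutive_pierce: "pierce_T (consecutive_pierce m) = consecutive_pierce (Suc m)"
  using consecutive_pierce_bounds(1)[of m]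
  by (simp add: pierce_T_def pierce_d1_consecutive_pierce consecutive_pierce_Suc)

lemma consecutive_pierce_le: "consecutive_pierce m \<le> 1 / real (Suc m)"
  using consecutive_pierce_bounds(2)[of m] by (simp add: field_simps)

lemma consecutive_pierce_in_pierce_div_set:
  assumes "s \<le> 1"
  shows "consecutive_pierce m \<in> pierce_div_set s"
proof -
  have "(pierce_T ^^ n) (consecutive_pierce m) = consecutive_pierce (m + n)" for n
    by (induction n) (simp_all add: pierce_T_consecutive_pierce)
  then have eq: "pierce_term s (consecutive_pierce m) n = 1 / real (Suc (m + n)) powr s" for n
    by (simp add: pierce_term_def pierce_digit_def pierce_d1_consecutive_pierce
        real_of_ereal_inverse_enat_powr del: enat_powr.simps(1))
  have le: "inverse (real (n + Suc m)) \<le> pierce_term s (consecutive_pierce m) n" for n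
  proof -
    have "real (Suc (m + n)) powr s \<le> real (Suc (m + n)) powr 1"
      using assms by (intro powr_mono) auto
    then have "1 / real (Suc (m + n)) \<le> 1 / real (Suc (m + n)) powr s"
      by (intro divide_left_mono) auto
    then show ?thesis
      unfolding eq by (simp add: inverse_eq_divide add.commute)
  qed
  have "\<not> summable (\<lambda>n. inverse (real (n + Suc m)))"
    using not_summable_harmonic[where 'a = real]
      summable_iff_shift[of "\<lambda>n. inverse (real n)" "Suc m"] by blast
  then have "\<not> summable (pierce_term s (consecutive_pierce m))"
    using le summable_comparison_test'[of "pierce_term s (consecutive_pierce m)" 0
        "\<lambda>n. inverse (real (n + Suc m))"] by auto
  moreover have "consecutive_pierce m \<le> 1"
    using consecutive_pierce_le[of m] by (rule order_trans) simp
  ultimately show ?thesis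
    using consecutive_pierce_nonneg by (simp add: pierce_div_set_eq)
qed

section \<open>The divergence set is dense\<close>

lemma pierce_T_in_pierce_div_set_imp:
  assumes "x \<in> {0..1}" "pierce_T x \<in> pierce_div_set s"
  shows "x \<in> pierce_div_set s"
proof -
  have "pierce_term s x (Suc n) = pierce_term s (pierce_T x) n" for n
    by (simp add: pierce_term_def pierce_digit_def funpow_swap1)
  then show ?thesis
    using assms summable_Suc_iff[of "pierce_term s x"] by (simp add: pierce_div_set_eq)
qed

text \<open>For a point with first digit \<open>d\<close>, the inverse branch \<open>y \<mapsto> (1 - y)/d\<close> of \<open>T\<close> produces points
  of first digit \<open>d\<close> as long as \<open>0 \<le> y < 1/(d+1)\<close>. Since \<open>T x\<close> satisfies this strict bound, all
  points of \<open>D\<close> close enough to \<open>T x\<close> do, even when \<open>T x = 0\<close> and \<open>T\<close> is discontinuous at \<open>x\<close>.\<close>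

lemma closure_pierce_div_set_pullback:
  assumes x: "0 < x" "x \<le> 1" and T: "pierce_T x \<in> closure (pierce_div_set s)"
  shows "x \<in> closure (pierce_div_set s)"
  unfolding closure_approachable
proof (intro allI impI)
  fix e :: real assume "e > 0"
  define d where "d = nat \<lfloor>1 / x\<rfloor>"
  have "real d = of_int \<lfloor>1 / x\<rfloor>"
    using x by (simp add: d_def)
  then have "real d \<le> 1 / x" "1 / x < real d + 1"
    by linarith+
  then have d: "real d * x \<le> 1" "1 < (real d + 1) * x"
    using x by (simp_all add: field_simps)
  have "d \<ge> 1"
    using x by (simp add: d_def le_nat_iff le_floor_iff)
  have Tx: "pierce_T x = 1 - real d * x"
    using x by (simp add: pierce_T_of_pos d_def)
  have "pierce_T x < 1 / (real d + 1)"
  proof -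
    have "(real d + 1) * pierce_T x < 1"
      unfolding Tx using d(2) mult_strict_left_mono[OF d(2), of "real d"] \<open>d \<ge> 1\<close>
      by (simp add: algebra_simps)
    then show ?thesis
      by (simp add: field_simps)
  qed
  then have "min e (1 / (real d + 1) - pierce_T x) > 0"
    using \<open>e > 0\<close> by simp
  then obtain y where y: "y \<in> pierce_div_set s"
    and "dist y (pierce_T x) < min e (1 / (real d + 1) - pierce_T x)"
    using T unfolding closure_approachable by blast
  then have y_less: "y < 1 / (real d + 1)" and y_near: "\<bar>y - pierce_T x\<bar> < e"
    by (auto simp: dist_real_def)
  have "0 \<le> y"
    using y by (simp add: pierce_div_set_eq)
  define z where "z = (1 - y) / real d"
  have dz: "real d * z = 1 - y"
    using \<open>d \<ge> 1\<close> by (simp add: z_def)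
  have "1 / (real d + 1) \<le> 1"
    by simp
  then have "y < 1"
    using y_less by linarith
  then have "0 < z"
    using \<open>d \<ge> 1\<close> by (simp add: z_def)
  have "1 < (real d + 1) * z"
  proof -
    have "(real d + 1) * y < 1"
      using y_less by (simp add: field_simps)
    then have "real d < (real d + 1) * (real d * z)"
      unfolding dz by (simp add: algebra_simps)
    then have "real d * 1 < real d * ((real d + 1) * z)"
      by (simp add: algebra_simps)
    then show ?thesis
      using \<open>d \<ge> 1\<close> by (simp add: mult_less_cancel_left_pos)
  qed
  then have "pierce_d1 z = enat d"
    using \<open>0 < z\<close> \<open>0 \<le> y\<close> dz by (intro pierce_d1_eq_of_bounds) auto
  then have "pierce_T z = y"
    using \<open>0 < z\<close> dz by (simp add: pierce_T_def)
  moreover have "z \<le> real d * z"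
    using \<open>0 < z\<close> \<open>d \<ge> 1\<close> by simp
  then have "z \<le> 1"
    using dz \<open>0 \<le> y\<close> by linarith
  ultimately have "z \<in> pierce_div_set s"
    using y \<open>0 < z\<close> pierce_T_in_pierce_div_set_imp[of z s] by simp
  moreover have "dist z x < e"
  proof -
    have "real d * (z - x) = pierce_T x - y"
      using dz Tx by (simp add: algebra_simps)
    then have "real d * \<bar>z - x\<bar> = \<bar>y - pierce_T x\<bar>"
      by (metis abs_minus_commute abs_mult abs_of_nat)
    moreover have "\<bar>z - x\<bar> \<le> real d * \<bar>z - x\<bar>"
      using \<open>d \<ge> 1\<close> mult_right_mono[of 1 "real d" "\<bar>z - x\<bar>"] by simp
    ultimately show ?thesis
      using y_near by (simp add: dist_real_def)
  qed
  ultimately show "\<exists>z\<in>pierce_div_set s. dist z x < e"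
    by blast
qed

text \<open>The Pierce map runs the Euclidean algorithm on the pair \<open>(p, q)\<close> with \<open>q\<close> held fixed: it sends
  \<open>p/q\<close> to \<open>(q mod p)/q\<close>.\<close>

lemma rational_in_closure_pierce_div_set:
  assumes "s \<le> 1" "p \<le> q" "0 < q"
  shows "real p / real q \<in> closure (pierce_div_set s)"
  using assms(2)
proof (induction p rule: less_induct)
  case (less p)
  show ?case
  proof (cases "p = 0")
    case True
    have "\<exists>y\<in>pierce_div_set s. dist y 0 < e" if "e > 0" for e :: real
    proof -
      obtain m where "inverse (real (Suc m)) < e"
        using reals_Archimedean \<open>e > 0\<close> by blast
      then have "dist (consecutive_pierce m) 0 < e"
        using consecutive_pierce_le[of m] consecutive_pierce_nonneg[of m]
        by (simp add: inverse_eq_divide)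
      then show ?thesis
        using consecutive_pierce_in_pierce_div_set[OF assms(1)] by blast
    qed
    then show ?thesis
      using True by (simp add: closure_approachable)
  next
    case False
    have "\<lfloor>1 / (real p / real q)\<rfloor> = int (q div p)"
      by (simp add: floor_divide_of_nat_eq)
    then have "pierce_T (real p / real q) = 1 - real (q div p) * (real p / real q)"
      using False assms(3) by (simp add: pierce_T_of_pos)
    also have "\<dots> = (real q - real (q div p * p)) / real q"
      using assms(3) by (simp add: field_simps)
    also have "real q - real (q div p * p) = real (q mod p)"
      by (metis add_diff_cancel_left' div_mult_mod_eq of_nat_add)
    finally have "pierce_T (real p / real q) = real (q mod p) / real q" .
    moreover have "q mod p < p" "q mod p \<le> q"
      using False by auto
    ultimately have T: "pierce_T (real p / real q) \<in> closure (pierce_div_set s)"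
      using less.IH by simp
    have "0 < real p / real q" "real p / real q \<le> 1"
      using False assms(3) less.prems by simp_all
    then show ?thesis
      using T by (rule closure_pierce_div_set_pullback)
  qed
qed

lemma closure_of_pierce_div_set:
  assumes "s \<le> 1"
  shows "(top_of_set {0..1}) closure_of (pierce_div_set s) = {0..1}"
proof -
  have sub: "pierce_div_set s \<subseteq> {0..1}"
    by (auto simp: pierce_div_set_eq)
  have "x \<in> closure (pierce_div_set s)" if x: "x \<in> {0..1}" for x
  proof -
    have "x \<in> closure (closure (pierce_div_set s))"
      unfolding closure_approachable[of x "closure _"]
    proof (intro allI impI)
      fix e :: real assume "e > 0"
      then obtain n where n: "inverse (real (Suc n)) < e"
        using reals_Archimedean by blast
      define q p where "q = Suc n" and "p = nat \<lfloor>real q * x\<rfloor>"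
      have "real p = of_int \<lfloor>real q * x\<rfloor>"
        using x by (simp add: p_def)
      then have p: "real p \<le> real q * x" "real q * x < real p + 1"
        by linarith+
      moreover have "real q * x \<le> real q"
        using x by (simp add: mult_left_le)
      ultimately have "p \<le> q"
        by linarith
      then have "real p / real q \<in> closure (pierce_div_set s)"
        using assms by (intro rational_in_closure_pierce_div_set) (auto simp: q_def)
      moreover have "dist (real p / real q) x < e"
      proof -
        have q: "real q > 0"
          by (simp add: q_def)
        then have "real p / real q \<le> x" "x < real p / real q + inverse (real q)"
          using p by (simp_all add: field_simps)
        then show ?thesis
          using n by (simp add: dist_real_def q_def)
      qed
      ultimately show "\<exists>y\<in>closure (pierce_div_set s). dist y x < e"
        by blast
    qed
    then show ?thesis
      by simp
  qed
  then show ?thesis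
    using sub by (auto simp: closure_of_subtopology Int_absorb1)
qed

section \<open>Topological and cardinal size of the divergence set\<close>

theorem theorem1p13:
  fixes s :: real
  assumes "0 < s" and "s \<le> 1"
  shows "(top_of_set {0..1}) closure_of (pierce_div_set s) = {0..1}
    \<and> gdelta_in (top_of_set {0..1}) (pierce_div_set s)
    \<and> comeager_in (top_of_set {0..1}) (pierce_div_set s)
    \<and> nonmeager_in (top_of_set {0..1}) (pierce_div_set s)
    \<and> pierce_div_set s \<approx> (UNIV :: real set)"
proof -
  let ?I = "top_of_set {0..1::real}"
  have complete: "completely_metrizable_space ?I"
    using completely_metrizable_space_cbox[of 0 "1::real"] by simp
  have dense: "?I closure_of (pierce_div_set s) = topspace ?I"
    using closure_of_pierce_div_set[OF assms(2)] by simp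
  have comeager: "comeager_in ?I (pierce_div_set s)"
    using gdelta_in_pierce_div_set dense by (rule dense_gdelta_imp_comeager_in)
  moreover have "nonmeager_in ?I (pierce_div_set s)"
    using complete _ comeager by (rule comeager_in_imp_nonmeager_in) simp
  moreover have "(UNIV :: real set) \<lesssim> pierce_div_set s"
    using complete _ not_openin_singleton_unit_interval gdelta_in_pierce_div_set dense
    by (rule reals_lepoll_dense_gdelta) simp
  then have "pierce_div_set s \<approx> (UNIV :: real set)"
    by (intro lepoll_antisym) (simp_all add: subset_imp_lepoll)
  ultimately show ?thesis
    using gdelta_in_pierce_div_set closure_of_pierce_div_set[OF assms(2)] by simp
qed

end
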